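(* Let $\mathcal A=SU(2)_8$, with the boson $\gamma=8$ condensed, and let $(1,\tau)$, $(\tau,1)$, $\zeta$, $\tilde\zeta$ be the sectors of the broken phase $\mathcal T$ described in the context. Let $V$ be the complex vector space with basis $|4,b;c\rangle$, $b\in\{1,7\}$, $c\in\{3,5\}$, whose elements represent the fusion vertices of $\mathcal A$ with upper legs $4,b$ and lower leg $c$. Let $$v_{(1,\tau)}=2^{-3/4}\left(i\,|4,1;3\rangle-e^{i\pi/4}|4,1;5\rangle+e^{i\pi/4}|4,7;3\rangle+|4,7;5\rangle\right),$$ $$v_{(\tau,1)}=2^{-3/4}\left(i\,|4,1;3\rangle+e^{i\pi/4}|4,1;5\rangle-e^{i\pi/4}|4,7;3\rangle+|4,7;5\rangle\right)$$ be the lifts to $\mathcal A$ of the $\mathcal T$ vertices with lower leg $\tilde\zeta$ and upper legs $(1,\tau),\zeta$, respectively $(\tau,1),\zeta$. Let $M_{\mathcal A}:V\to V$ be the monodromy, $M_{\mathcal A}|a,b;c\rangle=\frac{\theta_c}{\theta_a\theta_b}|a,b;c\rangle$. Then $$M_{\mathcal A}v_{(1,\tau)}=e^{-3\pi i/5}\,v_{(\tau,1)},\qquad M_{\mathcal A}v_{(\tau,1)}=e^{-3\pi i/5}\,v_{(1,\tau)} .$$ That is, the monodromy with the confined sector $\zeta$ acts on the pair of sectors $\big((1,\tau),(\tau,1)\big)$ by $e^{-3\pi i/5}\sigma_x$, where $\sigma_x$ is the Pauli matrix exchanging $(1,\tau)$ and $(\tau,1)$.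
   Context: $SU(2)_8$ has sectors $0,1,\dots,8$ (with $0$ the vacuum), fusion rules $a\times b=\sum_c c$ over $c=|a-b|,|a-b|+2,\dots,\min\{a+b,16-a-b\}$, and topological phases $\theta_a=e^{2\pi i\,a(a+2)/40}$. The sector $8$ satisfies $8\times8=0$, $8\times a=8-a$ and $\theta_8=1$. Condensing $8$ identifies sectors related by fusion with $8$ and splits the fixed sector $4$. The sectors of the resulting phase $\mathcal T$, with their lifts to $\mathcal A$, are: the vacuum $\mathbf 1$ (lifts $0,8$); $(\tau,\tau)$ (lifts $2,6$); $(1,\tau)$ and $(\tau,1)$ (each with the single lift $4$); and the confined sectors $\zeta$ (lifts $1,7$) and $\tilde\zeta$ (lifts $3,5$). The unconfined sectors $\mathbf 1,(1,\tau),(\tau,1),(\tau,\tau)$ have the fusion rules of the chiral Fibonacci$\,\times\,$Fibonacci model. The lift of a $\mathcal T$ vertex with upper legs $r,s$ and lower leg $t$ is a linear combination of the $\mathcal A$ vertices with upper legs $a,b$ and lower leg $c$, where $a,b,c$ range over lifts of $r,s,t$. The coefficients (vertex lifting coefficients) in the cases used here are those displayed in $v_{(1,\tau)}$ and $v_{(\tau,1)}$. *)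

theory Defs
  imports "HOL-Analysis.Analysis"
begin

section \<open>The theory SU(2) at level 8\<close>

text \<open>Sectors are the natural numbers up to 8, so the subtractions below do not truncate.\<close>

definition sectors :: "nat set" where
  "sectors = {0..8}"

definition fusion :: "nat \<Rightarrow> nat \<Rightarrow> nat set" where
  "fusion a b = {c. \<exists>k. c = nat \<bar>int a - int b\<bar> + 2 * k \<and> c \<le> min (a + b) (16 - a - b)}"

definition theta :: "nat \<Rightarrow> complex" where
  "theta a = exp (2 * of_real pi * \<i> * of_nat (a * (a + 2)) / 40)"

definition boson :: nat where
  "boson = 8"

lemma fusion_boson:
  assumes "a \<in> sectors"
  shows "fusion boson a = {boson - a}"
proof -
  have "nat \<bar>int 8 - int a\<bar> = 8 - a" "min (8 + a) (16 - 8 - a) = 8 - a"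
    using assms by (auto simp: sectors_def)
  then have "fusion 8 a = {c. \<exists>k. c = 8 - a + 2 * k \<and> c \<le> 8 - a}"
    unfolding fusion_def by (simp only:)
  then show ?thesis
    by (auto simp: boson_def)
qed

lemma theta_boson: "theta boson = 1"
  using exp_integer_2pi[of 2] by (simp add: theta_def boson_def algebra_simps)


section \<open>The phase after condensation of the boson\<close>

datatype bsector = Vac | TauTau | OneTau | TauOne | Zeta | ZetaTilde

fun lifts :: "bsector \<Rightarrow> nat set" where
  "lifts Vac = {0, 8}"
| "lifts TauTau = {2, 6}"
| "lifts OneTau = {4}"
| "lifts TauOne = {4}"
| "lifts Zeta = {1, 7}"
| "lifts ZetaTilde = {3, 5}"

text \<open>The condensation identifies sectors exchanged by fusion with the boson.\<close>

lemma lifts_boson_orbit: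
  assumes "a \<in> lifts r"
  shows "lifts r = insert a (fusion boson a)"
proof -
  have "a \<in> sectors" using assms by (cases r) (auto simp: sectors_def)
  then have "fusion boson a = {8 - a}"
    using fusion_boson unfolding boson_def by blast
  moreover have "lifts r = {a, 8 - a}"
    using assms by (cases r) auto
  ultimately show ?thesis
    by simp
qed

text \<open>
  The triple \<open>(a, b, c)\<close> stands for the fusion vertex with upper legs \<open>a\<close>, \<open>b\<close> and lower
  leg \<open>c\<close>; all fusion multiplicities are at most one.
\<close>

definition lifted_vertices :: "bsector \<Rightarrow> bsector \<Rightarrow> bsector \<Rightarrow> (nat \<times> nat \<times> nat) set" where
  "lifted_vertices r s t =
     {(a, b, c). a \<in> lifts r \<and> b \<in> lifts s \<and> c \<in> lifts t \<and> c \<in> fusion a b}"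


section \<open>The vertex space and the monodromy\<close>

typedef vertex = "{(4, b, c) | b c. b \<in> {1, 7} \<and> c \<in> {3, 5}} :: (nat \<times> nat \<times> nat) set"
  by blast

lemma range_Rep_vertex:
  "range Rep_vertex = {4} \<times> {1, 7} \<times> {3, 5}"
  using type_definition.Rep_range[OF type_definition_vertex] by auto

instance vertex :: finite
proof
  have "finite (range Rep_vertex)"
    by (simp add: range_Rep_vertex)
  moreover have "inj Rep_vertex"
    by (simp add: inj_def Rep_vertex_inject)
  ultimately show "finite (UNIV :: vertex set)"
    by (rule finite_imageD)
qed

lemma range_Rep_vertex_lifted:
  "range Rep_vertex = lifted_vertices OneTau Zeta ZetaTilde"
  "range Rep_vertex = lifted_vertices TauOne Zeta ZetaTilde"
proof -
  have "3 \<in> fusion 4 1" "5 \<in> fusion 4 1" "3 \<in> fusion 4 7" "5 \<in> fusion 4 7"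
    by (simp_all add: fusion_def)
  then show "range Rep_vertex = lifted_vertices OneTau Zeta ZetaTilde"
    "range Rep_vertex = lifted_vertices TauOne Zeta ZetaTilde"
    by (auto simp: range_Rep_vertex lifted_vertices_def)
qed

type_synonym vertex_space = "complex ^ vertex"

text \<open>
  The ket is a standard basis vector when \<open>(a, b, c)\<close> represents a vertex, and zero otherwise.
\<close>

definition ket :: "nat \<Rightarrow> nat \<Rightarrow> nat \<Rightarrow> vertex_space" where
  "ket a b c = (\<chi> w. if Rep_vertex w = (a, b, c) then 1 else 0)"

definition monodromy :: "vertex_space \<Rightarrow> vertex_space" where
  "monodromy x =
     (\<chi> w. case Rep_vertex w of (a, b, c) \<Rightarrow> theta c / (theta a * theta b) * x $ w)"

lemma ket_eq_axis: "Rep_vertex w = (a, b, c) \<Longrightarrow> ket a b c = axis w 1"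
  by (auto simp: ket_def axis_def vec_eq_iff simp flip: Rep_vertex_inject)

lemma monodromy_ket: "monodromy (ket a b c) = (theta c / (theta a * theta b)) *s ket a b c"
  by (auto simp: monodromy_def ket_def vec_eq_iff split: prod.splits)

lemma linear_monodromy: "Vector_Spaces.linear (*s) (*s) monodromy"
  by unfold_locales
    (auto simp: monodromy_def vec_eq_iff distrib_left add_divide_distrib split: prod.splits)


section \<open>Lifts of the broken-phase vertices\<close>

text \<open>
  Lifts of the vertices with lower leg \<open>ZetaTilde\<close> and upper legs \<open>OneTau\<close>, \<open>Zeta\<close>,
  respectively \<open>TauOne\<close>, \<open>Zeta\<close>, given by their vertex lifting coefficients.
\<close>

definition v_OneTau :: vertex_space where
  "v_OneTau = of_real (2 powr (- 3 / 4)) *s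
     (\<i> *s ket 4 1 3 - exp (\<i> * of_real pi / 4) *s ket 4 1 5
      + exp (\<i> * of_real pi / 4) *s ket 4 7 3 + ket 4 7 5)"

definition v_TauOne :: vertex_space where
  "v_TauOne = of_real (2 powr (- 3 / 4)) *s
     (\<i> *s ket 4 1 3 + exp (\<i> * of_real pi / 4) *s ket 4 1 5
      - exp (\<i> * of_real pi / 4) *s ket 4 7 3 + ket 4 7 5)"

definition pauli_x :: "complex ^ 2 ^ 2" where
  "pauli_x = vector [vector [0, 1], vector [1, 0]]"

text \<open>
  The \<open>i\<close>-th column of \<open>A\<close> contains the coefficients of the image of the \<open>i\<close>-th vector of
  the pair.
\<close>

definition acts_on_pair_by ::
  "(vertex_space \<Rightarrow> vertex_space) \<Rightarrow> vertex_space \<Rightarrow> vertex_space \<Rightarrow> complex ^ 2 ^ 2 \<Rightarrow> bool" where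
  "acts_on_pair_by f v w A \<longleftrightarrow>
     (let p = (vector [v, w] :: vertex_space ^ 2)
      in \<forall>i. f (p $ i) = (\<Sum>j\<in>UNIV. A $ j $ i *s p $ j))"

end

theory Submission
  imports Defs
begin

text \<open>
  The monodromy is diagonal on the vertices. Its phase is the same number
  \<open>exp (- 3 * pi * \<i> / 5)\<close> on \<open>|4,1;3\<rangle>\<close> and \<open>|4,7;5\<rangle>\<close>, and minus that number on
  \<open>|4,1;5\<rangle>\<close> and \<open>|4,7;3\<rangle>\<close>, which are the vertices whose coefficients have opposite signs in
  the two lifts.
\<close>

text \<open>Gathering the three twists into one exponential reduces comparing phases to integer
  arithmetic on the values \<open>a * (a + 2)\<close>.\<close>

lemma monodromy_phase_eq_exp:
  "theta c / (theta a * theta b) =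
     exp (of_real pi * \<i> * (of_nat (c * (c + 2)) - of_nat (a * (a + 2)) - of_nat (b * (b + 2))) / 20)"
  unfolding theta_def exp_add[symmetric] exp_diff[symmetric]
  by (rule arg_cong[where f = exp]) (simp add: field_simps)

text \<open>Shifts by multiples of \<open>pi * \<i>\<close>, not only \<open>2 * pi * \<i>\<close>,
  are allowed, so that phases equal up to sign can be compared; the parity of \<open>k\<close> is
  the sign.\<close>

lemma exp_eq_exp_shift:
  fixes x y :: complex and k :: int
  assumes "x = y + of_int k * (of_real pi * \<i>)"
  shows "exp x = (- 1) powi k * exp y"
proof -
  have "exp (of_int k * (of_real pi * \<i>)) = (- 1) powi k"
    by (simp flip: exp_power_int)
  then show ?thesis
    by (simp add: assms exp_add)
qed

lemma monodromy_phases: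
  defines "z \<equiv> exp (- 3 * of_real pi * \<i> / 5)"
  shows "theta 3 / (theta 4 * theta 1) = z"
    and "theta 5 / (theta 4 * theta 1) = - z"
    and "theta 3 / (theta 4 * theta 7) = - z"
    and "theta 5 / (theta 4 * theta 7) = z"
proof -
  \<comment> \<open>In units of \<open>pi * \<i>\<close> the four exponents are -3/5, 2/5, -18/5 and
    -13/5; each \<open>k\<close> below is the exponent's offset from -3/5.\<close>
  note shift = exp_eq_exp_shift[of _ "- 3 * of_real pi * \<i> / 5"]
  show "theta 3 / (theta 4 * theta 1) = z"
    unfolding monodromy_phase_eq_exp z_def by (subst shift[where k = 0]) (simp_all add: field_simps)
  show "theta 5 / (theta 4 * theta 1) = - z"
    unfolding monodromy_phase_eq_exp z_def by (subst shift[where k = 1]) (simp_all add: field_simps)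
  show "theta 3 / (theta 4 * theta 7) = - z"
    unfolding monodromy_phase_eq_exp z_def by (subst shift[where k = "- 3"]) (simp_all add: field_simps)
  show "theta 5 / (theta 4 * theta 7) = z"
    unfolding monodromy_phase_eq_exp z_def by (subst shift[where k = "- 2"]) (simp_all add: field_simps)
qed

lemmas monodromy_linear_simps =
  vec.linear_add[OF linear_monodromy] vec.linear_diff[OF linear_monodromy]
  vec.linear_scale[OF linear_monodromy]

theorem mainTheorem2:
  shows "monodromy v_OneTau = exp (- 3 * of_real pi * \<i> / 5) *s v_TauOne \<and>
    monodromy v_TauOne = exp (- 3 * of_real pi * \<i> / 5) *s v_OneTau \<and>
    acts_on_pair_by monodromy v_OneTau v_TauOne
      (\<chi> j i. exp (- 3 * of_real pi * \<i> / 5) * pauli_x $ j $ i)"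
proof -
  have one: "monodromy v_OneTau = exp (- 3 * of_real pi * \<i> / 5) *s v_TauOne"
    unfolding v_OneTau_def v_TauOne_def monodromy_linear_simps monodromy_ket monodromy_phases
    by (simp add: vec_eq_iff algebra_simps)
  have two: "monodromy v_TauOne = exp (- 3 * of_real pi * \<i> / 5) *s v_OneTau"
    unfolding v_OneTau_def v_TauOne_def monodromy_linear_simps monodromy_ket monodromy_phases
    by (simp add: vec_eq_iff algebra_simps)
  show ?thesis
    \<comment> \<open>The diagonal entries vanish, so the condition on each column is one of the two
      equations.\<close>
    using one two
    by (simp add: acts_on_pair_by_def pauli_x_def forall_2 sum_2)
qed

end
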